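(* Let $A,B \subseteq 2^{\mathbb{N}}$. Then $A$ and $B$ can be separated by a monotone circuit (that is, there is a monotone circuit $C$ with $C(x) = 1$ for all $x \in A$ and $C(y) = 0$ for all $y \in B$) if and only if the monotone Karchmer--Wigderson game $\mathrm{mKW}_{A,B}$ has a communication protocol.
   Context: $2^{\mathbb{N}}$ is the Cantor space of infinite binary strings $x = x_0x_1\cdots$. Circuits. A circuit $C$ is a countable, well-founded (no infinite branch) rooted tree whose nodes (gates) are labeled: every node with at least one child is labeled $\wedge$ or $\vee$; every leaf is labeled $0$, $1$, $x_i$, or $\overline{x}_i$ for some $i \in \mathbb{N}$. On input $x \in 2^{\mathbb{N}}$, gates are evaluated inductively: a leaf evaluates to its label ($x_i$ is the $i$-th bit of $x$, $\overline{x}_i$ its negation), an $\wedge$-gate to the conjunction and an $\vee$-gate to the disjunction of the evaluations of its children. $C(x)$ is the evaluation of the root. A circuit is monotone if no leaf is labeled by a negated literal $\overline{x}_i$. Infinite communication protocols. Let $X = Y = 2^{\mathbb{N}}$ and let $Z$ be a countable set. A protocol $P$ is a countable, well-founded rooted tree in which each internal node $v$ is labeled either by a function $a_v \colon X \to \mathbb{N}$ (Alice's node) or by a function $b_v \colon Y \to \mathbb{N}$ (Bob's node), these functions being arbitrary, and each leaf is labeled by an element of $Z$. Every edge is labeled with some natural number, and for each internal node $v$ and each $n$ in the range of $a_v$ (resp. $b_v$), exactly one edge from $v$ to one of its children is labeled $n$. The protocol computes a function $P \colon X \times Y \to Z$: on input $(x,y)$ start at the root; at an internal node $v$ follow the edge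 labeled $a_v(x)$ (if $v$ is Alice's) or $b_v(y)$ (if $v$ is Bob's); output the label of the leaf eventually reached. Monotone KW games. In $\mathrm{mKW}_{A,B}$, Alice gets $x \in A$, Bob gets $y \in B$, and they must output some $i \in \mathbb{N}$ with $x_i = 1$ and $y_i = 0$. A protocol $P$ with $Z = \mathbb{N}$ is a communication protocol for $\mathrm{mKW}_{A,B}$ if for all $(x,y) \in A \times B$, the index $i = P(x,y)$ satisfies $x_i = 1$ and $y_i = 0$. *)

theory Defs
  imports Main "HOL-Library.Countable"
begin

type_synonym cantor = "nat \<Rightarrow> bool"

section \<open>Countable well-founded rooted trees\<close>

text \<open>
  A countable rooted tree is represented, up to isomorphism, by a prefix-closed set of finite
  sequences of naturals with root \<open>[]\<close>; the last entry of a sequence only distinguishes siblings.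
\<close>

definition children :: "nat list set \<Rightarrow> nat list \<Rightarrow> nat list set" where
  "children T v = {w \<in> T. \<exists>k. w = v @ [k]}"

definition wf_tree :: "nat list set \<Rightarrow> bool" where
  "wf_tree T \<longleftrightarrow> [] \<in> T \<and> (\<forall>v k. v @ [k] \<in> T \<longrightarrow> v \<in> T) \<and>
     \<not> (\<exists>f :: nat \<Rightarrow> nat. \<forall>n. map f [0..<n] \<in> T)"

definition is_leaf :: "nat list set \<Rightarrow> nat list \<Rightarrow> bool" where
  "is_leaf T v \<longleftrightarrow> v \<in> T \<and> children T v = {}"

definition is_internal :: "nat list set \<Rightarrow> nat list \<Rightarrow> bool" where
  "is_internal T v \<longleftrightarrow> v \<in> T \<and> children T v \<noteq> {}"

definition child_rel :: "nat list set \<Rightarrow> (nat list \<times> nat list) set" where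
  "child_rel T = {(w, v). w \<in> children T v}"

lemma wf_child_rel:
  assumes "wf_tree T"
  shows "wf (child_rel T)"
proof (rule ccontr)
  assume "\<not> wf (child_rel T)"
  then obtain s where s: "\<And>i. (s (Suc i), s i) \<in> child_rel T"
    by (auto simp: wf_iff_no_infinite_down_chain)
  have mem: "s (Suc i) \<in> T" and ext: "\<exists>k. s (Suc i) = s i @ [k]" for i
    using s[of i] by (auto simp: child_rel_def children_def)
  have closed: "v \<in> T" if "v @ u \<in> T" for v u
    using that
  proof (induction u rule: rev_induct)
    case (snoc k u)
    then show ?case
      using assms unfolding wf_tree_def by (metis append.assoc)
  qed simp
  have len: "length (s i) = length (s 0) + i" for i
  proof (induction i)
    case (Suc i)
    then show ?case using ext[of i] by auto
  qed simp
  have pre: "\<exists>u. s (i + d) = s i @ u" for i d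
  proof (induction d)
    case (Suc d)
    then show ?case using ext[of "i + d"] by auto
  qed simp
  define f where "f n = s (Suc n) ! n" for n
  have "map f [0..<n] \<in> T" for n
  proof -
    have "s (Suc n) ! j = f j" if "j < n" for j
    proof -
      obtain u where "s (Suc j + (n - j)) = s (Suc j) @ u"
        using pre by blast
      then show ?thesis
        using that len[of "Suc j"] by (simp add: f_def nth_append)
    qed
    then have "take n (s (Suc n)) = map f [0..<n]"
      using len[of "Suc n"] by (intro nth_equalityI) auto
    moreover have "take n (s (Suc n)) \<in> T"
      using closed[of "take n (s (Suc n))" "drop n (s (Suc n))"] mem[of n] by simp
    ultimately show ?thesis by simp
  qed
  then show False
    using assms unfolding wf_tree_def by blast
qed

section \<open>Circuits\<close>

datatype gate_kind = And_Gate | Or_Gate | Const bool | Pos_Lit nat | Neg_Lit nat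

record circuit =
  gates :: "nat list set"
  gate_label :: "nat list \<Rightarrow> gate_kind"

definition is_circuit :: "circuit \<Rightarrow> bool" where
  "is_circuit C \<longleftrightarrow> wf_tree (gates C) \<and>
     (\<forall>v. is_internal (gates C) v \<longrightarrow> gate_label C v \<in> {And_Gate, Or_Gate}) \<and>
     (\<forall>v. is_leaf (gates C) v \<longrightarrow> gate_label C v \<in> range Const \<union> range Pos_Lit \<union> range Neg_Lit)"

definition monotone_circuit :: "circuit \<Rightarrow> bool" where
  "monotone_circuit C \<longleftrightarrow> (\<forall>v. is_leaf (gates C) v \<longrightarrow> gate_label C v \<notin> range Neg_Lit)"

text \<open>The guard only makes the recursion terminate; the value on non-circuits is irrelevant.\<close>

function gate_value :: "circuit \<Rightarrow> cantor \<Rightarrow> nat list \<Rightarrow> bool" where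
  "gate_value C x v =
     (if wf_tree (gates C)
      then (case gate_label C v of
              And_Gate \<Rightarrow> \<forall>w \<in> children (gates C) v. gate_value C x w
            | Or_Gate \<Rightarrow> \<exists>w \<in> children (gates C) v. gate_value C x w
            | Const b \<Rightarrow> b
            | Pos_Lit i \<Rightarrow> x i
            | Neg_Lit i \<Rightarrow> \<not> x i)
      else False)"
  by pat_completeness auto
termination
proof (relation "same_fst (\<lambda>C. wf_tree (gates C)) (\<lambda>C. same_fst (\<lambda>_. True) (\<lambda>_. child_rel (gates C)))")
  show "wf (same_fst (\<lambda>C. wf_tree (gates C)) (\<lambda>C. same_fst (\<lambda>_::cantor. True) (\<lambda>_. child_rel (gates C))))"
    by (intro wf_same_fst wf_child_rel)
qed (auto simp: same_fst_def child_rel_def)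

declare gate_value.simps [simp del]

definition circuit_value :: "circuit \<Rightarrow> cantor \<Rightarrow> bool" where
  "circuit_value C x = gate_value C x []"

definition separates :: "circuit \<Rightarrow> cantor set \<Rightarrow> cantor set \<Rightarrow> bool" where
  "separates C A B \<longleftrightarrow> (\<forall>x\<in>A. circuit_value C x = True) \<and> (\<forall>y\<in>B. circuit_value C y = False)"

section \<open>Infinite communication protocols\<close>

datatype 'z node_kind = Alice "cantor \<Rightarrow> nat" | Bob "cantor \<Rightarrow> nat" | Output 'z

text \<open>\<open>edge_label P w\<close> is the label of the edge from the parent of \<open>w\<close> to \<open>w\<close>.\<close>

record 'z protocol =
  nodes :: "nat list set"
  node_label :: "nat list \<Rightarrow> 'z node_kind"
  edge_label :: "nat list \<Rightarrow> nat"

text \<open>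
  Edges whose label is outside the range of the function at their source are allowed, and
  unconstrained.
\<close>

definition is_protocol :: "'z::countable protocol \<Rightarrow> bool" where
  "is_protocol P \<longleftrightarrow> wf_tree (nodes P) \<and>
     (\<forall>v. is_leaf (nodes P) v \<longrightarrow> node_label P v \<in> range Output) \<and>
     (\<forall>v. is_internal (nodes P) v \<longrightarrow>
        (\<exists>g. (node_label P v = Alice g \<or> node_label P v = Bob g) \<and>
             (\<forall>n \<in> range g. \<exists>!w. w \<in> children (nodes P) v \<and> edge_label P w = n)))"

definition follow :: "'z protocol \<Rightarrow> nat list \<Rightarrow> nat \<Rightarrow> nat list" where
  "follow P v n = (THE w. w \<in> children (nodes P) v \<and> edge_label P w = n)"

lemma follow_children:
  assumes "is_protocol P" "v \<in> nodes P" "node_label P v = Alice g \<or> node_label P v = Bob g"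
  shows "follow P v (g x) \<in> children (nodes P) v"
proof -
  have "\<not> is_leaf (nodes P) v"
    using assms unfolding is_protocol_def by fastforce
  then have "is_internal (nodes P) v"
    using assms(2) by (simp add: is_leaf_def is_internal_def)
  then obtain g' where "node_label P v = Alice g' \<or> node_label P v = Bob g'"
    and "\<forall>n \<in> range g'. \<exists>!w. w \<in> children (nodes P) v \<and> edge_label P w = n"
    using assms(1) unfolding is_protocol_def by blast
  then have "\<exists>!w. w \<in> children (nodes P) v \<and> edge_label P w = g x"
    using assms(3) by (metis node_kind.inject(1,2) node_kind.distinct(1) rangeI)
  from theI'[OF this] show ?thesis
    by (simp add: follow_def)
qed

text \<open>The guard only makes the recursion terminate; it holds at every node reached by a protocol.\<close>

function output_from :: "'z::countable protocol \<Rightarrow> cantor \<Rightarrow> cantor \<Rightarrow> nat list \<Rightarrow> 'z" where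
  "output_from P x y v =
     (if is_protocol P \<and> v \<in> nodes P
      then (case node_label P v of
              Alice a \<Rightarrow> output_from P x y (follow P v (a x))
            | Bob b \<Rightarrow> output_from P x y (follow P v (b y))
            | Output z \<Rightarrow> z)
      else undefined)"
  by pat_completeness auto
termination
proof (relation "same_fst is_protocol (\<lambda>P. same_fst (\<lambda>_. True) (\<lambda>_. same_fst (\<lambda>_. True) (\<lambda>_. child_rel (nodes P))))")
  show "wf (same_fst is_protocol (\<lambda>P :: 'z::countable protocol.
          same_fst (\<lambda>_::cantor. True) (\<lambda>_. same_fst (\<lambda>_::cantor. True) (\<lambda>_. child_rel (nodes P)))))"
    by (intro wf_same_fst wf_child_rel) (simp add: is_protocol_def)
qed (auto simp: same_fst_def child_rel_def intro: follow_children)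

declare output_from.simps [simp del]

definition protocol_output :: "'z::countable protocol \<Rightarrow> cantor \<Rightarrow> cantor \<Rightarrow> 'z" where
  "protocol_output P x y = output_from P x y []"

section \<open>Monotone Karchmer--Wigderson games\<close>

definition solves_mKW :: "cantor set \<Rightarrow> cantor set \<Rightarrow> nat protocol \<Rightarrow> bool" where
  "solves_mKW A B P \<longleftrightarrow>
     (\<forall>x\<in>A. \<forall>y\<in>B. x (protocol_output P x y) = True \<and> y (protocol_output P x y) = False)"

end

theory Submission
  imports Defs
begin

text \<open>
  Circuits and protocols are translated into each other on the \<^emph>\<open>same\<close> tree: an \<open>\<or>\<close>-gate
  corresponds to a node of Alice, an \<open>\<and>\<close>-gate to a node of Bob, and a leaf labelled with a variable
  \<open>x\<^sub>i\<close> to the output \<open>i\<close>.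

  From a circuit separating \<open>A\<close> from \<open>B\<close>, the players obtain a protocol by walking down from the
  root while keeping the invariant that the current gate is true on \<open>x\<close> and false on \<open>y\<close>. At
  an \<open>\<or>\<close>-gate every child is false on \<open>y\<close>, and Alice knows a child that is true on \<open>x\<close>; at an
  \<open>\<and>\<close>-gate Bob dually knows a child that is false on \<open>y\<close>. At a leaf the invariant excludes
  constants, so by monotonicity the leaf is some \<open>x\<^sub>i\<close>, and \<open>i\<close> is a correct answer
  (\<open>play_from_separating_gate\<close>).

  Conversely, the inputs that are compatible with reaching a node \<open>v\<close> of a protocol form a
  rectangle \<open>A\<^sub>v \<times> B\<^sub>v\<close>. By induction from the leaves upwards, the gate at \<open>v\<close> separates \<open>A\<^sub>v\<close> from
  \<open>B\<^sub>v\<close> (\<open>gate_separates_rectangle\<close>): at a node of Alice, her message partitions \<open>A\<^sub>v\<close> among the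
  children and leaves \<open>B\<^sub>v\<close> unchanged, so a disjunction is what is needed; Bob's nodes are dual. At
  a leaf with output \<open>i\<close> and nonempty rectangle, correctness of the protocol says that \<open>x\<^sub>i\<close> separates
  \<open>A\<^sub>v\<close> from \<open>B\<^sub>v\<close>. An empty rectangle says nothing about \<open>i\<close>, but then one of its sides is empty and a
  constant separates. At the root the rectangle is \<open>A \<times> B\<close>.
\<close>

section \<open>Trees\<close>

lemma leaf_or_internal: "v \<in> T \<Longrightarrow> is_leaf T v \<or> is_internal T v"
  by (auto simp: is_leaf_def is_internal_def)

lemma wf_tree_induct [consumes 2, case_names node]:
  assumes "wf_tree T" "v \<in> T"
    and step: "\<And>v. v \<in> T \<Longrightarrow> (\<And>w. w \<in> children T v \<Longrightarrow> Q w) \<Longrightarrow> Q v"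
  shows "Q v"
  using wf_child_rel[OF assms(1)] assms(2)
proof (induction v rule: wf_induct_rule)
  case (less v)
  show ?case
  proof (rule step[OF less.prems])
    fix w
    assume "w \<in> children T v"
    then show "Q w"
      by (intro less.IH) (auto simp: child_rel_def children_def)
  qed
qed

lemma children_eq_if_last_eq:
  "v \<in> children T u \<Longrightarrow> w \<in> children T u \<Longrightarrow> last v = last w \<Longrightarrow> v = w"
  by (auto simp: children_def)

section \<open>From circuits to protocols\<close>

lemma gate_value_cases:
  assumes "is_circuit C"
  shows "gate_label C v = And_Gate \<Longrightarrow>
           gate_value C x v \<longleftrightarrow> (\<forall>w \<in> children (gates C) v. gate_value C x w)"
    and "gate_label C v = Or_Gate \<Longrightarrow>
           gate_value C x v \<longleftrightarrow> (\<exists>w \<in> children (gates C) v. gate_value C x w)"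
    and "gate_label C v = Const b \<Longrightarrow> gate_value C x v \<longleftrightarrow> b"
    and "gate_label C v = Pos_Lit i \<Longrightarrow> gate_value C x v \<longleftrightarrow> x i"
  using assms by (simp_all add: is_circuit_def gate_value.simps[of C x v])

text \<open>
  The message names a child of value \<open>b\<close> if there is one, and otherwise an arbitrary child: an
  internal node must answer every input, also those that never reach it.
\<close>

definition child_with_value :: "circuit \<Rightarrow> bool \<Rightarrow> nat list \<Rightarrow> cantor \<Rightarrow> nat list" where
  "child_with_value C b v x = (SOME w. w \<in> children (gates C) v \<and>
     ((\<exists>w' \<in> children (gates C) v. gate_value C x w' = b) \<longrightarrow> gate_value C x w = b))"

definition protocol_of_circuit :: "circuit \<Rightarrow> nat protocol" where
  "protocol_of_circuit C = \<lparr>nodes = gates C,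
     node_label = (\<lambda>v. case gate_label C v of
         Or_Gate \<Rightarrow> Alice (\<lambda>x. last (child_with_value C True v x))
       | And_Gate \<Rightarrow> Bob (\<lambda>y. last (child_with_value C False v y))
       | Pos_Lit i \<Rightarrow> Output i
       | _ \<Rightarrow> Output 0),
     edge_label = last\<rparr>"

lemma child_with_value:
  assumes "children (gates C) v \<noteq> {}"
  shows "child_with_value C b v x \<in> children (gates C) v"
    and "\<exists>w \<in> children (gates C) v. gate_value C x w = b \<Longrightarrow>
           gate_value C x (child_with_value C b v x) = b"
proof -
  have "\<exists>w. w \<in> children (gates C) v \<and>
      ((\<exists>w' \<in> children (gates C) v. gate_value C x w' = b) \<longrightarrow> gate_value C x w = b)"
    using assms by blast
  from someI_ex[OF this]
  show "child_with_value C b v x \<in> children (gates C) v"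
    and "\<exists>w \<in> children (gates C) v. gate_value C x w = b \<Longrightarrow>
           gate_value C x (child_with_value C b v x) = b"
    unfolding child_with_value_def by blast+
qed

lemma is_protocol_protocol_of_circuit:
  assumes "is_circuit C"
  shows "is_protocol (protocol_of_circuit C)"
proof -
  have leaf: "node_label (protocol_of_circuit C) v \<in> range Output" if "is_leaf (gates C) v" for v
    using assms that unfolding is_circuit_def protocol_of_circuit_def by fastforce
  have unique: "\<exists>!w. w \<in> children (gates C) v \<and> last w = n"
    if "is_internal (gates C) v" "n \<in> range (\<lambda>x. last (child_with_value C b v x))" for v n b
    using that child_with_value(1)[of C v b] children_eq_if_last_eq
    by (fastforce simp: is_internal_def)
  have internal: "\<exists>g. (node_label (protocol_of_circuit C) v = Alice g \<or>
                       node_label (protocol_of_circuit C) v = Bob g) \<and>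
      (\<forall>n \<in> range g. \<exists>!w. w \<in> children (gates C) v \<and> last w = n)"
    if "is_internal (gates C) v" for v
  proof -
    have "gate_label C v = And_Gate \<or> gate_label C v = Or_Gate"
      using assms that by (auto simp: is_circuit_def)
    then show ?thesis
    proof
      assume "gate_label C v = And_Gate"
      then show ?thesis
        using unique[OF that, of _ False]
        by (intro exI[of _ "\<lambda>y. last (child_with_value C False v y)"])
          (simp add: protocol_of_circuit_def)
    next
      assume "gate_label C v = Or_Gate"
      then show ?thesis
        using unique[OF that, of _ True]
        by (intro exI[of _ "\<lambda>x. last (child_with_value C True v x)"])
          (simp add: protocol_of_circuit_def)
    qed
  qed
  have "nodes (protocol_of_circuit C) = gates C" "edge_label (protocol_of_circuit C) = last"
    by (simp_all add: protocol_of_circuit_def)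
  moreover have "wf_tree (gates C)"
    using assms by (simp add: is_circuit_def)
  ultimately show ?thesis
    unfolding is_protocol_def using leaf internal by (metis (no_types, lifting))
qed

lemma follow_protocol_of_circuit:
  assumes "w \<in> children (gates C) v"
  shows "follow (protocol_of_circuit C) v (last w) = w"
  unfolding follow_def using assms children_eq_if_last_eq
  by (intro the_equality) (auto simp: protocol_of_circuit_def)

text \<open>
  Play preserves the invariant that the current gate distinguishes \<open>x\<close> from \<open>y\<close>: the chosen child
  distinguishes them because the player choosing makes it right for her own input, and the gate's
  value makes every child right for the input of the other.
\<close>

lemma play_from_separating_gate:
  assumes "is_circuit C" "monotone_circuit C" "v \<in> gates C"
    and "gate_value C x v" "\<not> gate_value C y v"
  shows "x (output_from (protocol_of_circuit C) x y v) \<and>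
         \<not> y (output_from (protocol_of_circuit C) x y v)"
proof -
  let ?P = "protocol_of_circuit C"
  have "wf_tree (gates C)"
    using assms(1) by (simp add: is_circuit_def)
  from this assms(3) show ?thesis
    using assms(4,5)
  proof (induction v rule: wf_tree_induct)
    case (node v)
    have out: "output_from ?P x y v = (case node_label ?P v of
                Alice a \<Rightarrow> output_from ?P x y (follow ?P v (a x))
              | Bob b \<Rightarrow> output_from ?P x y (follow ?P v (b y))
              | Output z \<Rightarrow> z)"
      using node.hyps is_protocol_protocol_of_circuit[OF assms(1)]
      by (subst output_from.simps) (simp add: protocol_of_circuit_def)
    from leaf_or_internal[OF node.hyps] show ?case
    proof
      assume leaf: "is_leaf (gates C) v"
      then consider b where "gate_label C v = Const b" | i where "gate_label C v = Pos_Lit i"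
        using assms(1,2) unfolding is_circuit_def monotone_circuit_def by blast
      then show ?thesis
        using node.prems out
        by cases (auto simp: gate_value_cases[OF assms(1)] protocol_of_circuit_def)
    next
      assume internal: "is_internal (gates C) v"
      then have ne: "children (gates C) v \<noteq> {}"
        by (simp add: is_internal_def)
      consider "gate_label C v = Or_Gate" | "gate_label C v = And_Gate"
        using assms(1) internal by (auto simp: is_circuit_def)
      then show ?thesis
      proof cases
        case 1
        let ?w = "child_with_value C True v x"
        have w: "?w \<in> children (gates C) v" "gate_value C x ?w" "\<not> gate_value C y ?w"
          using child_with_value[OF ne, where b = True and x = x] node.prems
          by (auto simp: gate_value_cases(2)[OF assms(1) 1])
        have "output_from ?P x y v = output_from ?P x y (follow ?P v (last ?w))"
          using out 1 by (simp add: protocol_of_circuit_def)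
        then show ?thesis
          using node.IH[OF w] w(1) by (simp add: follow_protocol_of_circuit)
      next
        case 2
        let ?w = "child_with_value C False v y"
        have w: "?w \<in> children (gates C) v" "gate_value C x ?w" "\<not> gate_value C y ?w"
          using child_with_value[OF ne, where b = False and x = y] node.prems
          by (auto simp: gate_value_cases(1)[OF assms(1) 2])
        have "output_from ?P x y v = output_from ?P x y (follow ?P v (last ?w))"
          using out 2 by (simp add: protocol_of_circuit_def)
        then show ?thesis
          using node.IH[OF w] w(1) by (simp add: follow_protocol_of_circuit)
      qed
    qed
  qed
qed

section \<open>From protocols to circuits\<close>

text \<open>
  With \<open>K\<close> one of the constructors \<open>Alice\<close> and \<open>Bob\<close>, these are the inputs from \<open>S\<close> with which that
  player sends, at each of her own nodes above \<open>v\<close>, the message leading towards \<open>v\<close>. The input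
  pairs reaching \<open>v\<close> thus form the rectangle \<open>consistent P Alice A v \<times> consistent P Bob B v\<close>.
\<close>

definition consistent ::
  "'z protocol \<Rightarrow> ((cantor \<Rightarrow> nat) \<Rightarrow> 'z node_kind) \<Rightarrow> cantor set \<Rightarrow> nat list \<Rightarrow> cantor set" where
  "consistent P K S v = {x \<in> S. \<forall>u k s g.
     v = u @ k # s \<longrightarrow> node_label P u = K g \<longrightarrow> edge_label P (u @ [k]) = g x}"

lemma consistent_Nil [simp]: "consistent P K S [] = S"
  by (simp add: consistent_def)

lemma consistent_snoc:
  "x \<in> consistent P K S (v @ [k]) \<longleftrightarrow>
     x \<in> consistent P K S v \<and> (\<forall>g. node_label P v = K g \<longrightarrow> edge_label P (v @ [k]) = g x)"
proof -
  have split: "v @ [k] = u @ j # s \<longleftrightarrow> (u = v \<and> j = k \<and> s = []) \<or> (\<exists>s'. s = s' @ [k] \<and> v = u @ j # s')"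
    for u j s
    by (cases s rule: rev_cases) auto
  show ?thesis
    unfolding consistent_def mem_Collect_eq split by (simp add: all_conj_distrib) auto
qed

lemma consistent_child:
  assumes "w \<in> children (nodes P) v"
  shows "x \<in> consistent P K S w \<longleftrightarrow>
     x \<in> consistent P K S v \<and> (\<forall>g. node_label P v = K g \<longrightarrow> edge_label P w = g x)"
  using assms by (auto simp: children_def consistent_snoc)

lemma internal_unique_edge:
  assumes "is_protocol P" "is_internal (nodes P) v"
    and "node_label P v = Alice g \<or> node_label P v = Bob g"
  shows "\<exists>!w. w \<in> children (nodes P) v \<and> edge_label P w = g x"
proof -
  obtain h where "node_label P v = Alice h \<or> node_label P v = Bob h"
    and "\<forall>n \<in> range h. \<exists>!w. w \<in> children (nodes P) v \<and> edge_label P w = n"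
    using assms(1,2) unfolding is_protocol_def by blast
  moreover from this(1) have "h = g"
    using assms(3) by auto
  ultimately show ?thesis
    by blast
qed

lemma follow_eq:
  assumes "is_protocol P" "w \<in> children (nodes P) v" "edge_label P w = g x"
    and "node_label P v = Alice g \<or> node_label P v = Bob g"
  shows "follow P v (g x) = w"
proof -
  have "is_internal (nodes P) v"
    using assms(1,2) by (auto simp: is_internal_def children_def is_protocol_def wf_tree_def)
  from internal_unique_edge[OF assms(1) this assms(4)] show ?thesis
    unfolding follow_def using assms(2,3) by (intro the1_equality) auto
qed

text \<open>
  Every input pair of the rectangle at \<open>v\<close> is indeed played through \<open>v\<close>.
\<close>

lemma output_from_consistent:
  fixes P :: "'z::countable protocol"
  assumes "is_protocol P" "v \<in> nodes P"
    and "x \<in> consistent P Alice A v" "y \<in> consistent P Bob B v"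
  shows "output_from P x y v = protocol_output P x y"
  using assms(2-4)
proof (induction v rule: rev_induct)
  case Nil
  then show ?case
    by (simp add: protocol_output_def)
next
  case (snoc k v)
  have v: "v \<in> nodes P"
    using snoc.prems(1) assms(1) by (auto simp: is_protocol_def wf_tree_def)
  have child: "v @ [k] \<in> children (nodes P) v"
    using snoc.prems(1) by (simp add: children_def)
  then have "is_internal (nodes P) v"
    using v by (auto simp: is_internal_def)
  then obtain g where g: "node_label P v = Alice g \<or> node_label P v = Bob g"
    using assms(1) unfolding is_protocol_def by blast
  have "output_from P x y v = output_from P x y (v @ [k])"
    using g
  proof
    assume l: "node_label P v = Alice g"
    then have "follow P v (g x) = v @ [k]"
      using snoc.prems(2) by (intro follow_eq[OF assms(1) child]) (auto simp: consistent_snoc)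
    then show ?thesis
      using assms(1) v l by (simp add: output_from.simps[of P x y v])
  next
    assume l: "node_label P v = Bob g"
    then have "follow P v (g y) = v @ [k]"
      using snoc.prems(3) by (intro follow_eq[OF assms(1) child]) (auto simp: consistent_snoc)
    then show ?thesis
      using assms(1) v l by (simp add: output_from.simps[of P x y v])
  qed
  with snoc.IH[OF v] snoc.prems(2,3) show ?case
    by (simp add: consistent_snoc)
qed

definition circuit_of_protocol :: "nat protocol \<Rightarrow> cantor set \<Rightarrow> cantor set \<Rightarrow> circuit" where
  "circuit_of_protocol P A B = \<lparr>gates = nodes P,
     gate_label = (\<lambda>v. case node_label P v of
         Alice _ \<Rightarrow> Or_Gate
       | Bob _ \<Rightarrow> And_Gate
       | Output i \<Rightarrow>
           if consistent P Alice A v = {} then Const False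
           else if consistent P Bob B v = {} then Const True
           else Pos_Lit i)\<rparr>"

lemma circuit_of_protocol_monotone_circuit:
  assumes "is_protocol P"
  shows "is_circuit (circuit_of_protocol P A B)" "monotone_circuit (circuit_of_protocol P A B)"
proof -
  have leaf: "\<exists>i. node_label P v = Output i" if "is_leaf (nodes P) v" for v
    using assms that by (auto simp: is_protocol_def)
  have internal: "\<exists>g. node_label P v = Alice g \<or> node_label P v = Bob g"
    if "is_internal (nodes P) v" for v
    using assms that by (fastforce simp: is_protocol_def)
  show "is_circuit (circuit_of_protocol P A B)"
    using assms by (auto simp: is_circuit_def circuit_of_protocol_def is_protocol_def
        split: if_splits dest!: leaf internal)
  show "monotone_circuit (circuit_of_protocol P A B)"
    by (auto simp: monotone_circuit_def circuit_of_protocol_def split: if_splits dest!: leaf)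
qed

text \<open>
  The claim ranges over all nodes, including those that no input pair reaches. This is essential:
  at an \<open>\<or>\<close>-gate \<^emph>\<open>all\<close> children must be false on \<open>B\<^sub>v\<close>, also a child that Alice never chooses,
  and the constants at the leaves below such a child achieve this.
\<close>

lemma gate_separates_rectangle:
  assumes "is_protocol P" "solves_mKW A B P" "v \<in> nodes P"
  shows "(\<forall>x \<in> consistent P Alice A v. gate_value (circuit_of_protocol P A B) x v) \<and>
         (\<forall>y \<in> consistent P Bob B v. \<not> gate_value (circuit_of_protocol P A B) y v)"
proof -
  let ?C = "circuit_of_protocol P A B"
  note gate_value_C = gate_value_cases[OF circuit_of_protocol_monotone_circuit(1)[OF assms(1)]]
  have gates_C [simp]: "gates ?C = nodes P"
    by (simp add: circuit_of_protocol_def)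
  have "wf_tree (nodes P)"
    using assms(1) by (simp add: is_protocol_def)
  from this assms(3) show ?thesis
  proof (induction v rule: wf_tree_induct)
    case (node v)
    from leaf_or_internal[OF node.hyps] show ?case
    proof
      assume "is_leaf (nodes P) v"
      then obtain i where i: "node_label P v = Output i"
        using assms(1) by (auto simp: is_protocol_def)
      have correct: "x i \<and> \<not> y i"
        if "x \<in> consistent P Alice A v" "y \<in> consistent P Bob B v" for x y
      proof -
        have "protocol_output P x y = i"
          using output_from_consistent[OF assms(1) node.hyps that] assms(1) node.hyps i
          by (simp add: output_from.simps[of P x y v])
        moreover have "x \<in> A" "y \<in> B"
          using that by (auto simp: consistent_def)
        ultimately show ?thesis
          using assms(2) by (auto simp: solves_mKW_def)
      qed
      consider "consistent P Alice A v = {}" "gate_label ?C v = Const False"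
        | "consistent P Bob B v = {}" "gate_label ?C v = Const True"
        | "consistent P Alice A v \<noteq> {}" "consistent P Bob B v \<noteq> {}" "gate_label ?C v = Pos_Lit i"
        using i
        by (cases "consistent P Alice A v = {}"; cases "consistent P Bob B v = {}")
          (simp_all add: circuit_of_protocol_def)
      then show ?thesis
      proof cases
        case 1
        then show ?thesis
          using gate_value_C(3)[OF 1(2)] by simp
      next
        case 2
        then show ?thesis
          using gate_value_C(3)[OF 2(2)] by simp
      next
        case 3
        then show ?thesis
          using correct gate_value_C(4)[OF 3(3)] by auto
      qed
    next
      assume internal: "is_internal (nodes P) v"
      then obtain g where g: "node_label P v = Alice g \<or> node_label P v = Bob g"
        using assms(1) unfolding is_protocol_def by blast
      then have edge: "\<exists>w \<in> children (nodes P) v. edge_label P w = g x" for x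
        using internal_unique_edge[OF assms(1) internal] by blast
      from g show ?thesis
      proof
        assume l: "node_label P v = Alice g"
        then have "gate_label ?C v = Or_Gate"
          by (simp add: circuit_of_protocol_def)
        note val = gate_value_C(2)[OF this, unfolded gates_C]
        show ?thesis
          unfolding val using node.IH edge l consistent_child[of _ P v]
          by (metis node_kind.distinct(1) node_kind.inject(1))
      next
        assume l: "node_label P v = Bob g"
        then have "gate_label ?C v = And_Gate"
          by (simp add: circuit_of_protocol_def)
        note val = gate_value_C(1)[OF this, unfolded gates_C]
        show ?thesis
          unfolding val using node.IH edge l consistent_child[of _ P v]
          by (metis node_kind.distinct(1) node_kind.inject(2))
      qed
    qed
  qed
qed

section \<open>The equivalence\<close>

theorem theorem6p6:
  fixes A B :: "cantor set"
  shows "(\<exists>C. is_circuit C \<and> monotone_circuit C \<and> separates C A B) \<longleftrightarrow>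
         (\<exists>P :: nat protocol. is_protocol P \<and> solves_mKW A B P)"
proof
  assume "\<exists>C. is_circuit C \<and> monotone_circuit C \<and> separates C A B"
  then obtain C where C: "is_circuit C" "monotone_circuit C" "separates C A B"
    by blast
  have "[] \<in> gates C"
    using C(1) by (simp add: is_circuit_def wf_tree_def)
  then have "solves_mKW A B (protocol_of_circuit C)"
    using play_from_separating_gate[OF C(1,2), of "[]"] C(3)
    by (auto simp: solves_mKW_def separates_def circuit_value_def protocol_output_def)
  then show "\<exists>P :: nat protocol. is_protocol P \<and> solves_mKW A B P"
    using is_protocol_protocol_of_circuit[OF C(1)] by blast
next
  assume "\<exists>P :: nat protocol. is_protocol P \<and> solves_mKW A B P"
  then obtain P :: "nat protocol" where P: "is_protocol P" "solves_mKW A B P"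
    by blast
  have "[] \<in> nodes P"
    using P(1) by (simp add: is_protocol_def wf_tree_def)
  then have "separates (circuit_of_protocol P A B) A B"
    using gate_separates_rectangle[OF P, of "[]"]
    by (simp add: separates_def circuit_value_def)
  then show "\<exists>C. is_circuit C \<and> monotone_circuit C \<and> separates C A B"
    using circuit_of_protocol_monotone_circuit[OF P(1)] by blast
qed

end
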